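(* Let $G$ be a finite connected regular simple graph with edge set $E$ and constant edge degree $d'(e)=2q\ge 4$ for all $e\in E$ (so every vertex has degree $q+1$). There is a constant $C_G>0$ depending only on $G$ such that for every function $f:E\to\mathbb{R}$ there is a number $\beta_{\max}\in\{\tfrac1q\}\cup[q^{-1/2},1)$ such that for every directed edge $a$ in $G$ and every integer $r\ge 0$ $$\Big|M_{r,a}(f)-\frac{1}{|E|}\sum_{e\in E}f(e)\Big|\le C_G\,\|f\|_2\,\beta_{\max}^{\,r}.$$
   Context: Simple means no loops and no multiple edges. The edge degree $d'(e)$ is the number of edges meeting $e$ in either of its endpoints (the degree of $e$ in the line graph). The norm is $\|f\|_2=\langle f,f\rangle^{1/2}$ with $\langle f,g\rangle=\sum_{e\in E}f(e)g(e)$. Universal cover: $\widetilde G$ is the universal covering tree of $G$, with vertex set $\widetilde V$ and edge set $\widetilde E$: fix a root vertex of $G$; the vertices of $\widetilde G$ are the non-backtracking paths in $G$ starting at the root, two being adjacent if they differ by exactly one edge at the end. The projection $\pi:\widetilde G\to G$ sends a path to its end vertex, and $\pi(\{\tilde v,\tilde w\})=\{\pi(\tilde v),\pi(\tilde w)\}$ on edges. The lift of $f$ is $\tilde f=f\circ\pi$. $\delta$ is the combinatorial distance between vertices. Edge spheres and arcs: for $v_0\in\widetilde V$, $S'_r(v_0)=\{e=\{x,y\}\in\widetilde E:\min\{\delta(x,v_0),\delta(y,v_0)\}=r\}$. For a directed edge $a$ of $\widetilde G$ from $w'$ to $w$, the edge arcs are $A'_0(a)=\{a\}$ and $A'_{r+1}(a)=S'_{r+1}(w')\cap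 S'_r(w)$ for $r\ge0$. The arc average is $$M_{r,a}(f)=\frac{1}{|A'_r(a)|}\sum_{x\in A'_r(a)}\tilde f(x).$$ For a directed edge $a$ of $G$, $M_{r,a}(f)$ is computed using any lift of $a$ to a directed edge of $\widetilde G$ (the value does not depend on the lift). The constant $C_G$ does not depend on $a$, $f$, $r$; the rate $\beta_{\max}$ may depend on $G$ and $f$ but not on $a$ or $r$. *)

theory Defs
  imports "HOL-Analysis.L2_Norm"
begin

text \<open>
  A graph is given by a vertex set \<open>V\<close> and a set \<open>E\<close> of two-element subsets of \<open>V\<close>; so there are
  no loops and no multiple edges. Graphs may be infinite, since the universal covering tree is
  treated as a graph in the same sense.
\<close>

definition simple_graph :: "'a set \<Rightarrow> 'a set set \<Rightarrow> bool" where
  "simple_graph V E \<longleftrightarrow> (\<forall>e\<in>E. e \<subseteq> V \<and> card e = 2)"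

definition walk :: "'a set \<Rightarrow> 'a set set \<Rightarrow> 'a list \<Rightarrow> bool" where
  "walk V E p \<longleftrightarrow> p \<noteq> [] \<and> set p \<subseteq> V \<and> successively (\<lambda>x y. {x, y} \<in> E) p"

definition connected_graph :: "'a set \<Rightarrow> 'a set set \<Rightarrow> bool" where
  "connected_graph V E \<longleftrightarrow>
     V \<noteq> {} \<and> (\<forall>x\<in>V. \<forall>y\<in>V. \<exists>p. walk V E p \<and> hd p = x \<and> last p = y)"

definition regular_graph :: "'a set \<Rightarrow> 'a set set \<Rightarrow> bool" where
  "regular_graph V E \<longleftrightarrow> (\<exists>d. \<forall>v\<in>V. card {e \<in> E. v \<in> e} = d)"

definition edge_degree :: "'a set set \<Rightarrow> 'a set \<Rightarrow> nat" where
  "edge_degree E e = card {e' \<in> E. e' \<noteq> e \<and> e' \<inter> e \<noteq> {}}"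

text \<open>The distance is only meaningful for vertices joined by a walk; a walk with
  \<open>n + 1\<close> vertices has length \<open>n\<close>.\<close>

definition graph_dist :: "'a set \<Rightarrow> 'a set set \<Rightarrow> 'a \<Rightarrow> 'a \<Rightarrow> nat" where
  "graph_dist V E x y =
     (LEAST n. \<exists>p. walk V E p \<and> hd p = x \<and> last p = y \<and> length p = Suc n)"

definition nonbacktracking :: "'a list \<Rightarrow> bool" where
  "nonbacktracking p \<longleftrightarrow> (\<forall>i. i + 2 < length p \<longrightarrow> p ! (i + 2) \<noteq> p ! i)"

text \<open>The universal covering tree. Its projection to the graph is \<^const>\<open>last\<close> on vertices, and
  the image under \<^const>\<open>last\<close> on edges.\<close>

definition cover_verts :: "'a set \<Rightarrow> 'a set set \<Rightarrow> 'a \<Rightarrow> 'a list set" where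
  "cover_verts V E v0 = {p. walk V E p \<and> hd p = v0 \<and> nonbacktracking p}"

definition cover_edges :: "'a set \<Rightarrow> 'a set set \<Rightarrow> 'a \<Rightarrow> 'a list set set" where
  "cover_edges V E v0 =
     {{p, p @ [v]} | p v. p \<in> cover_verts V E v0 \<and> p @ [v] \<in> cover_verts V E v0}"

definition edge_sphere :: "'a set \<Rightarrow> 'a set set \<Rightarrow> nat \<Rightarrow> 'a \<Rightarrow> 'a set set" where
  "edge_sphere V E r c =
     {{x, y} | x y. {x, y} \<in> E \<and> min (graph_dist V E x c) (graph_dist V E y c) = r}"

text \<open>The arcs of the directed edge from \<open>w'\<close> to \<open>w\<close>; to be used in a tree.\<close>

fun edge_arc :: "'a set \<Rightarrow> 'a set set \<Rightarrow> nat \<Rightarrow> 'a \<times> 'a \<Rightarrow> 'a set set" where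
  "edge_arc V E 0 (w', w) = {{w', w}}"
| "edge_arc V E (Suc r) (w', w) = edge_sphere V E (Suc r) w' \<inter> edge_sphere V E r w"

definition directed_edges :: "'a set set \<Rightarrow> ('a \<times> 'a) set" where
  "directed_edges E = {(x, y). {x, y} \<in> E}"

definition directed_lifts ::
    "'a set \<Rightarrow> 'a set set \<Rightarrow> 'a \<Rightarrow> 'a \<times> 'a \<Rightarrow> ('a list \<times> 'a list) set" where
  "directed_lifts V E v0 a =
     {b \<in> directed_edges (cover_edges V E v0). map_prod last last b = a}"

text \<open>The arc average for a directed edge \<open>b\<close> of the covering tree; the function \<open>f\<close> lives on the
  edges of the graph and is lifted by composing with the projection.\<close>

definition arc_average ::
    "'a set \<Rightarrow> 'a set set \<Rightarrow> 'a \<Rightarrow> nat \<Rightarrow> 'a list \<times> 'a list \<Rightarrow> ('a set \<Rightarrow> real) \<Rightarrow> real" where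
  "arc_average V E v0 r b f =
     (let A = edge_arc (cover_verts V E v0) (cover_edges V E v0) r b
      in (\<Sum>x\<in>A. f (last ` x)) / real (card A))"

text \<open>Every directed edge of a connected graph has a lift, whatever the root, so that
  statements quantified over all lifts are not vacuous.\<close>

lemma cover_step:
  assumes p: "p \<in> cover_verts V E v0" and e: "{last p, x} \<in> E" and x: "x \<in> V"
  shows "\<exists>p'. p' \<in> cover_verts V E v0 \<and> last p' = x \<and> {p, p'} \<in> cover_edges V E v0"
proof (cases "nonbacktracking (p @ [x])")
  case True
  then have "p @ [x] \<in> cover_verts V E v0"
    using p e x by (simp add: cover_verts_def walk_def successively_append_iff)
  then have "{p, p @ [x]} \<in> cover_edges V E v0" using p unfolding cover_edges_def by blast
  with \<open>p @ [x] \<in> cover_verts V E v0\<close> show ?thesis by (intro exI[of _ "p @ [x]"]) simp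
next
  case False
  then obtain i where i: "i + 2 < length (p @ [x])" "(p @ [x]) ! (i + 2) = (p @ [x]) ! i"
    unfolding nonbacktracking_def by blast
  have nb: "nonbacktracking p" using p by (simp add: cover_verts_def)
  have i2: "i + 2 = length p"
  proof (rule ccontr)
    assume "i + 2 \<noteq> length p"
    then have "i + 2 < length p" using i by simp
    then show False using i nb by (auto simp: nonbacktracking_def nth_append)
  qed
  then have pi: "p ! i = x" using i by (simp add: nth_append)
  define p' where "p' = butlast p"
  have ne: "p' \<noteq> []" using i2 by (cases p rule: rev_cases) (auto simp: p'_def)
  have pp: "p' @ [last p] = p"
    unfolding p'_def using i2 by (intro append_butlast_last_id) auto
  have "last p' = x"
  proof -
    have "last p' = p' ! (length p' - 1)" using ne by (rule last_conv_nth)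
    also have "length p' - 1 = i" using i2 by (simp add: p'_def)
    also have "p' ! i = p ! i" using i2 by (simp add: p'_def nth_butlast)
    finally show ?thesis using pi by simp
  qed
  moreover have "walk V E p'"
  proof -
    have "walk V E (p' @ [last p])" using p pp by (simp add: cover_verts_def)
    then show ?thesis using ne by (auto simp: walk_def successively_append_iff)
  qed
  moreover have "hd p' = v0"
  proof -
    have "hd (p' @ [last p]) = v0" using p pp by (simp add: cover_verts_def)
    then show ?thesis using ne by simp
  qed
  moreover have "nonbacktracking p'"
    using nb unfolding p'_def nonbacktracking_def by (simp add: nth_butlast)
  ultimately have p': "p' \<in> cover_verts V E v0" "last p' = x" by (auto simp: cover_verts_def)
  moreover have "p' @ [last p] \<in> cover_verts V E v0" using p pp by simp
  ultimately have "{p', p' @ [last p]} \<in> cover_edges V E v0" unfolding cover_edges_def by blast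
  then have "{p, p'} \<in> cover_edges V E v0" using pp by (simp add: insert_commute)
  then show ?thesis using p' by blast
qed

lemma cover_verts_surj:
  assumes "walk V E p" "hd p = v0"
  shows "\<exists>p'\<in>cover_verts V E v0. last p' = last p"
  using assms
proof (induction p rule: rev_induct)
  case Nil
  then show ?case by (simp add: walk_def)
next
  case (snoc x p)
  show ?case
  proof (cases "p = []")
    case True
    then have "[x] \<in> cover_verts V E v0"
      using snoc.prems by (auto simp: cover_verts_def nonbacktracking_def)
    then show ?thesis using True by force
  next
    case False
    then have "walk V E p" "hd p = v0" "{last p, x} \<in> E" "x \<in> V"
      using snoc.prems by (auto simp: walk_def successively_append_iff)
    then obtain p' where "p' \<in> cover_verts V E v0" "last p' = last p" using snoc.IH by blast
    then have "\<exists>p''. p'' \<in> cover_verts V E v0 \<and> last p'' = x \<and> {p', p''} \<in> cover_edges V E v0"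
      using \<open>{last p, x} \<in> E\<close> \<open>x \<in> V\<close> by (intro cover_step) simp_all
    then show ?thesis by auto
  qed
qed

lemma directed_lifts_nonempty:
  assumes "simple_graph V E" "connected_graph V E" "v0 \<in> V" "a \<in> directed_edges E"
  shows "directed_lifts V E v0 a \<noteq> {}"
proof -
  obtain u v where a: "a = (u, v)" "{u, v} \<in> E" using assms(4) by (auto simp: directed_edges_def)
  then have uv: "u \<in> V" "v \<in> V" using assms(1) by (auto simp: simple_graph_def)
  have "\<exists>w. walk V E w \<and> hd w = v0 \<and> last w = u"
    using assms(2,3) uv by (simp add: connected_graph_def)
  then obtain w where w: "walk V E w" "hd w = v0" "last w = u" by (elim exE conjE)
  obtain p where p: "p \<in> cover_verts V E v0" "last p = u"
    using cover_verts_surj[OF w(1,2)] w(3) by auto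
  have "\<exists>p'. p' \<in> cover_verts V E v0 \<and> last p' = v \<and> {p, p'} \<in> cover_edges V E v0"
    using p a uv by (intro cover_step) simp_all
  then obtain p' where "last p' = v" "{p, p'} \<in> cover_edges V E v0" by blast
  with p have "(p, p') \<in> directed_lifts V E v0 a"
    by (simp add: directed_lifts_def directed_edges_def a)
  then show ?thesis by blast
qed

end

theory Submission
  imports Defs "HOL-Library.Sublist" "HOL-Analysis.Function_Topology"
begin

text \<open>
  Let \<open>P\<close> be the operator on functions of directed edges that averages over the \<open>q\<close> non-backtracking
  continuations of an edge. In a tree the edges of the arc of radius \<open>r + 1\<close> of \<open>(w', w)\<close> are distributed
  over the arcs of radius \<open>r\<close> of the edges leaving \<open>w\<close> other than the one back to \<open>w'\<close>
  (\<open>edge_arc_Suc\<close>), and the covering projection maps the neighbours of a vertex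
  bijectively. So the arc average of \<open>f\<close> at any lift of \<open>a\<close> is \<open>(P ^^ r) F a\<close>, where \<open>F\<close> assigns
  \<open>f\<close> of the underlying edge to both directions (\<open>arc_average_eq\<close>).

  The rate is allowed to depend on the graph and to be any number in \<open>[q\<^sup>-\<^sup>1\<^sup>/\<^sup>2, 1)\<close>, so a
  spectral gap of \<open>P\<close> is enough, and the spectrum need not be computed. The operator contracts the
  norm of \<open>\<ell>\<^sup>2\<close>. An explicit variance identity (\<open>energy_nonbacktracking_average\<close>) shows that two steps
  preserve the norm only of functions constant on the edges leaving each vertex and on the edges
  entering it. The orthogonal complement of these functions is invariant under \<open>P\<close>, since the
  adjoint of \<open>P\<close> acts on them as the reversal of edges; by compactness \<open>P\<close> decays
  exponentially there (\<open>spectral_gap\<close>). Finally, \<open>F\<close> minus its mean lies in this complement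
  (\<open>star_orthogonal_symmetric\<close>). In the bipartite case this uses that \<open>F\<close> does not depend on the direction
  of an edge: \<open>P\<close> has the eigenvalue \<open>-1\<close>, but its eigenfunctions change sign under reversal.
\<close>

section \<open>Edge arcs in trees\<close>

definition nbrs :: "'a set set \<Rightarrow> 'a \<Rightarrow> 'a set" where
  "nbrs E v = {x. {v, x} \<in> E}"

lemma edge_sphere_iff:
  "{x, y} \<in> edge_sphere V E r c \<longleftrightarrow>
     {x, y} \<in> E \<and> min (graph_dist V E x c) (graph_dist V E y c) = r"
  unfolding edge_sphere_def by (auto simp: doubleton_eq_iff min.commute insert_commute)

text \<open>
  A function that vanishes at \<open>c\<close> and changes by at most one along edges bounds the distance to \<open>c\<close>
  from below; if every other vertex has a neighbour where it is one smaller, following such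
  neighbours yields a walk of exactly that length. This turns a guessed formula for the distance in
  the covering tree into the distance itself.
\<close>

lemma graph_dist_eqI:
  assumes c: "c \<in> V" "g c = 0" and x: "x \<in> V"
    and lipschitz: "\<And>x y. {x, y} \<in> E \<Longrightarrow> g x \<le> Suc (g y)"
    and descent: "\<And>x. x \<in> V \<Longrightarrow> x \<noteq> c \<Longrightarrow> \<exists>y\<in>V. {x, y} \<in> E \<and> g x = Suc (g y)"
  shows "graph_dist V E x c = g x"
  unfolding graph_dist_def
proof (rule Least_equality)
  show "\<exists>p. walk V E p \<and> hd p = x \<and> last p = c \<and> length p = Suc (g x)"
    using x
  proof (induction "g x" arbitrary: x)
    case 0
    then have "x = c" using descent by fastforce
    then show ?case using 0 by (intro exI[of _ "[c]"]) (simp add: walk_def)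
  next
    case (Suc n)
    then have "x \<noteq> c" using c by auto
    with Suc.prems descent obtain y where y: "y \<in> V" "{x, y} \<in> E" "g x = Suc (g y)" by blast
    with Suc.hyps(1)[of y] Suc.hyps(2)
    obtain p where "walk V E p" "hd p = y" "last p = c" "length p = Suc (g y)" by auto
    then show ?case using y Suc.prems
      by (intro exI[of _ "x # p"]) (auto simp: walk_def successively_Cons)
  qed
next
  fix n
  assume "\<exists>p. walk V E p \<and> hd p = x \<and> last p = c \<and> length p = Suc n"
  then obtain p where p: "walk V E p" "hd p = x" "last p = c" "length p = Suc n" by blast
  have "g (hd p) + 1 \<le> length p + g (last p)" if "walk V E p" for p
    using that
  proof (induction p)
    case Nil
    then show ?case by (simp add: walk_def)
  next
    case (Cons x p)
    show ?case
    proof (cases "p = []")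
      case False
      with Cons.prems have "walk V E p" "{x, hd p} \<in> E"
        by (auto simp: walk_def successively_Cons)
      with Cons.IH lipschitz[of x "hd p"] False show ?thesis by simp
    qed simp
  qed
  from this[OF p(1)] show "g x \<le> n" using p c by simp
qed

text \<open>
  The arcs depend on a tree only through its metric: the distances from \<open>c\<close> to the ends of an edge
  differ by exactly one, and every vertex other than \<open>c\<close> has exactly one neighbour closer to \<open>c\<close>.
\<close>

locale metric_tree =
  fixes V :: "'a set" and E :: "'a set set"
  assumes simple: "simple_graph V E"
    and dist_eq_0: "x \<in> V \<Longrightarrow> y \<in> V \<Longrightarrow> graph_dist V E x y = 0 \<longleftrightarrow> x = y"
    and dist_commute: "x \<in> V \<Longrightarrow> y \<in> V \<Longrightarrow> graph_dist V E x y = graph_dist V E y x"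
    and dist_edge: "{x, y} \<in> E \<Longrightarrow> c \<in> V \<Longrightarrow>
          graph_dist V E x c = Suc (graph_dist V E y c) \<or> graph_dist V E y c = Suc (graph_dist V E x c)"
    and closer_unique: "c \<in> V \<Longrightarrow> {x, y} \<in> E \<Longrightarrow> {x, z} \<in> E \<Longrightarrow>
          graph_dist V E x c = Suc (graph_dist V E y c) \<Longrightarrow> graph_dist V E x c = Suc (graph_dist V E z c) \<Longrightarrow> y = z"
    and closer_exists: "c \<in> V \<Longrightarrow> x \<in> V \<Longrightarrow> x \<noteq> c \<Longrightarrow>
          \<exists>y. {x, y} \<in> E \<and> graph_dist V E x c = Suc (graph_dist V E y c)"
begin

abbreviation "\<delta> \<equiv> graph_dist V E"

lemma edge_in: "{x, y} \<in> E \<Longrightarrow> x \<in> V \<and> y \<in> V \<and> x \<noteq> y"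
  using simple by (force simp: simple_graph_def)

text \<open>
  Removing \<open>w\<close> leaves one branch for each neighbour of \<open>w\<close>. An edge not incident to \<open>w\<close> lies in a single
  branch, whose neighbour is one step closer to both of its ends than \<open>w\<close>; every other neighbour of \<open>w\<close>
  is one step further away.
\<close>

lemma edge_sphere_branch:
  assumes w: "w \<in> V" and e: "e \<in> edge_sphere V E (Suc s) w"
  obtains z where "z \<in> nbrs E w" "e \<in> edge_sphere V E s z"
    "\<And>z'. z' \<in> nbrs E w \<Longrightarrow> z' \<noteq> z \<Longrightarrow> e \<in> edge_sphere V E (s + 2) z'"
proof -
  obtain x y where xy: "e = {x, y}" "{x, y} \<in> E" "\<delta> x w = Suc s" "\<delta> y w = Suc (Suc s)"
  proof -
    from e obtain x y where xy: "e = {x, y}" "{x, y} \<in> E" "min (\<delta> x w) (\<delta> y w) = Suc s"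
      unfolding edge_sphere_def by blast
    from dist_edge[OF xy(2) w] show ?thesis
    proof
      assume "\<delta> x w = Suc (\<delta> y w)"
      then show ?thesis using that[of y x] xy by (auto simp: insert_commute)
    next
      assume "\<delta> y w = Suc (\<delta> x w)"
      then show ?thesis using that[of x y] xy by auto
    qed
  qed
  note V = edge_in[OF xy(2)]
  have dist_step: "\<delta> c u = Suc (\<delta> c v) \<or> \<delta> c v = Suc (\<delta> c u)"
    if "{u, v} \<in> E" "c \<in> V" for c u v
    using dist_edge[OF that] dist_commute that edge_in[OF that(1)] by metis
  have "w \<noteq> x" using xy(3) dist_eq_0[OF w w] by auto
  then have "\<exists>z. {w, z} \<in> E \<and> \<delta> x w = Suc (\<delta> x z)"
    using closer_exists[of x w] dist_commute V w edge_in by metis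
  then obtain z where z: "{w, z} \<in> E" "\<delta> x w = Suc (\<delta> x z)" by blast
  then have zV: "z \<in> V" using edge_in by blast
  have zx: "\<delta> x z = s" using z(2) xy(3) by linarith
  have zy: "\<delta> y z = Suc s"
    using dist_step[OF z(1), of y] dist_edge[OF xy(2) zV] zx V xy(4) by linarith
  have unique: "\<delta> c w \<noteq> Suc (\<delta> c z')"
    if "\<delta> c w = Suc (\<delta> c z)" "{w, z'} \<in> E" "z' \<noteq> z" "c \<in> V" for c z'
    using closer_unique[OF that(4) z(1) that(2)] dist_commute that w zV edge_in by metis
  show thesis
  proof (rule that)
    show "z \<in> nbrs E w" using z by (simp add: nbrs_def)
    show "e \<in> edge_sphere V E s z" using xy zx zy by (simp add: edge_sphere_iff)
    fix z' assume z': "z' \<in> nbrs E w" "z' \<noteq> z"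
    then have E': "{w, z'} \<in> E" by (simp add: nbrs_def)
    have "\<delta> x z' = s + 2"
      using dist_step[OF E', of x] unique[OF z(2) E' z'(2)] V xy(3) by linarith
    moreover have "\<delta> y z' = s + 3"
      using dist_step[OF E', of y] unique[OF _ E' z'(2), of y] V zy xy(4) by linarith
    ultimately show "e \<in> edge_sphere V E (s + 2) z'" using xy by (simp add: edge_sphere_iff)
  qed
qed

lemma edge_sphere_inj:
  "e \<in> edge_sphere V E r c \<Longrightarrow> e \<in> edge_sphere V E s c \<Longrightarrow> r = s"
  by (auto simp: edge_sphere_def doubleton_eq_iff min.commute)

lemma edge_arc_1:
  assumes w: "{w', w} \<in> E"
  shows "edge_arc V E (Suc 0) (w', w) = (\<Union>z\<in>nbrs E w - {w'}. edge_arc V E 0 (w, z))"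
proof -
  have V: "w \<in> V" "w' \<in> V" "w' \<noteq> w" using edge_in[OF w] by auto
  have ww': "\<delta> w w' = 1" using dist_edge[OF w V(2)] dist_eq_0[OF V(2,2)] by auto
  have near: "e \<in> edge_sphere V E 0 w \<longleftrightarrow> (\<exists>z\<in>nbrs E w. e = {w, z})" for e
  proof
    assume "e \<in> edge_sphere V E 0 w"
    then obtain x y where "e = {x, y}" "{x, y} \<in> E" "\<delta> x w = 0 \<or> \<delta> y w = 0"
      unfolding edge_sphere_def by (auto simp: min_def split: if_splits)
    then show "\<exists>z\<in>nbrs E w. e = {w, z}"
      using dist_eq_0 edge_in[of x y] V unfolding nbrs_def by (auto simp: insert_commute)
  next
    assume "\<exists>z\<in>nbrs E w. e = {w, z}"
    then show "e \<in> edge_sphere V E 0 w"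
      using dist_eq_0[OF V(1,1)] by (auto simp: nbrs_def edge_sphere_iff)
  qed
  have "{w, z} \<in> edge_sphere V E (Suc 0) w' \<longleftrightarrow> z \<noteq> w'" if "z \<in> nbrs E w" for z
  proof -
    have "{w, z} \<in> E" "z \<in> V" using that edge_in by (auto simp: nbrs_def)
    moreover have "\<delta> z w' = 0 \<longleftrightarrow> z = w'" using dist_eq_0[of z w'] V \<open>z \<in> V\<close> by simp
    ultimately show ?thesis using ww' by (auto simp: edge_sphere_iff min_def)
  qed
  with near show ?thesis by (auto intro!: bexI)
qed

text \<open>
  The edges on the arc lie in the branches at \<open>w\<close> other than that of \<open>w'\<close>, because edges in the branch
  of \<open>w'\<close> are closer to \<open>w'\<close> than to \<open>w\<close>. This recursion is the reason why arc averages are iterates of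
  a single operator.
\<close>

lemma edge_arc_Suc:
  assumes w: "{w', w} \<in> E"
  shows "edge_arc V E (Suc r) (w', w) = (\<Union>z\<in>nbrs E w - {w'}. edge_arc V E r (w, z))"
proof (cases r)
  case 0
  then show ?thesis using edge_arc_1[OF w] by simp
next
  case (Suc s)
  have V: "w \<in> V" and w': "w' \<in> nbrs E w"
    using edge_in[OF w] w by (auto simp: nbrs_def insert_commute)
  have "e \<in> edge_sphere V E (s + 2) w' \<longleftrightarrow> (\<exists>z\<in>nbrs E w - {w'}. e \<in> edge_sphere V E s z)"
    if e: "e \<in> edge_sphere V E (Suc s) w" for e
  proof -
    obtain z where z: "z \<in> nbrs E w" "e \<in> edge_sphere V E s z"
      "\<And>z'. z' \<in> nbrs E w \<Longrightarrow> z' \<noteq> z \<Longrightarrow> e \<in> edge_sphere V E (s + 2) z'"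
      using edge_sphere_branch[OF V e] by metis
    show ?thesis
    proof
      assume "e \<in> edge_sphere V E (s + 2) w'"
      then have "z \<noteq> w'" using z(2) edge_sphere_inj[of e s w' "s + 2"] by auto
      then show "\<exists>z\<in>nbrs E w - {w'}. e \<in> edge_sphere V E s z" using z by blast
    next
      assume "\<exists>z\<in>nbrs E w - {w'}. e \<in> edge_sphere V E s z"
      then obtain z' where z': "z' \<in> nbrs E w" "z' \<noteq> w'" "e \<in> edge_sphere V E s z'" by blast
      then have "z' = z" using z(3)[of z'] edge_sphere_inj[of e s z' "s + 2"] by auto
      then have "w' \<noteq> z" using z'(2) by simp
      then show "e \<in> edge_sphere V E (s + 2) w'" using z(3) w' by blast
    qed
  qed
  then show ?thesis unfolding Suc by auto
qed

lemma edge_arc_disjoint: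
  assumes w: "w \<in> V" and z: "z \<in> nbrs E w" "z' \<in> nbrs E w" "z \<noteq> z'"
  shows "edge_arc V E r (w, z) \<inter> edge_arc V E r (w, z') = {}"
proof (cases r)
  case 0
  then show ?thesis using z by (auto simp: doubleton_eq_iff)
next
  case (Suc s)
  show ?thesis
  proof (rule ccontr)
    assume "\<not> ?thesis"
    then obtain e where e: "e \<in> edge_sphere V E (Suc s) w"
      "e \<in> edge_sphere V E s z" "e \<in> edge_sphere V E s z'" using Suc by auto
    obtain y where "\<And>z'. z' \<in> nbrs E w \<Longrightarrow> z' \<noteq> y \<Longrightarrow> e \<in> edge_sphere V E (s + 2) z'"
      using edge_sphere_branch[OF w e(1)] by metis
    then have "u = y" if "u \<in> nbrs E w" "e \<in> edge_sphere V E s u" for u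
      using edge_sphere_inj[of e s u "s + 2"] that by auto
    then show False using z e by blast
  qed
qed

lemma sum_edge_arc_Suc:
  assumes w: "{w', w} \<in> E" and fin: "finite (nbrs E w)"
    and arcs: "\<And>z. z \<in> nbrs E w \<Longrightarrow> finite (edge_arc V E r (w, z))"
  shows "sum g (edge_arc V E (Suc r) (w', w)) =
    (\<Sum>z\<in>nbrs E w - {w'}. sum g (edge_arc V E r (w, z)))"
  unfolding edge_arc_Suc[OF w]
  using fin arcs edge_arc_disjoint[of w _ _ r] edge_in[OF w]
  by (intro sum.UNION_disjoint) auto

end

section \<open>The metric of the covering tree\<close>

text \<open>
  Two non-backtracking paths with the same start are joined in the covering tree by erasing the first
  one down to their longest common prefix and then extending to the second one.
\<close>

fun path_dist :: "'a list \<Rightarrow> 'a list \<Rightarrow> nat" where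
  "path_dist [] ys = length ys"
| "path_dist xs [] = length xs"
| "path_dist (x # xs) (y # ys) =
     (if x = y then path_dist xs ys else length (x # xs) + length (y # ys))"

lemma path_dist_Nil2 [simp]: "path_dist xs [] = length xs"
  by (cases xs) auto

text \<open>
  Extending a path moves it towards \<open>c\<close> exactly when the extension is still a prefix of \<open>c\<close>. All metric
  properties of the covering tree come from this dichotomy.
\<close>

lemma path_dist_snoc:
  "if prefix (p @ [v]) c then path_dist p c = Suc (path_dist (p @ [v]) c)
   else path_dist (p @ [v]) c = Suc (path_dist p c)"
proof (induction p c rule: path_dist.induct)
  case (1 ys)
  then show ?case by (cases ys) auto
qed auto

lemma path_dist_eq_0 [simp]: "path_dist p c = 0 \<longleftrightarrow> p = c"
  by (induction p c rule: path_dist.induct) auto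

lemma path_dist_commute: "path_dist p c = path_dist c p"
  by (induction p c rule: path_dist.induct) auto

lemma cover_edgeE:
  assumes "{x, y} \<in> cover_edges V E v0"
  obtains v where "x \<in> cover_verts V E v0" "y \<in> cover_verts V E v0" "y = x @ [v] \<or> x = y @ [v]"
  using assms unfolding cover_edges_def by (auto simp: doubleton_eq_iff)

lemma cover_closer_iff:
  assumes "{x, y} \<in> cover_edges V E v0"
  shows "path_dist x c = Suc (path_dist y c) \<longleftrightarrow>
    (\<exists>v. y = x @ [v] \<and> prefix y c \<or> x = y @ [v] \<and> \<not> prefix x c)"
proof -
  obtain v where "y = x @ [v] \<or> x = y @ [v]" using assms by (rule cover_edgeE)
  then show ?thesis
  proof
    assume "y = x @ [v]"
    then show ?thesis using path_dist_snoc[of x v c] by (auto split: if_splits)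
  next
    assume "x = y @ [v]"
    then show ?thesis using path_dist_snoc[of y v c] by (auto split: if_splits)
  qed
qed

lemma cover_verts_prefix:
  assumes "p @ q \<in> cover_verts V E v0" "p \<noteq> []"
  shows "p \<in> cover_verts V E v0"
proof -
  have "nonbacktracking p"
    unfolding nonbacktracking_def
  proof (intro allI impI)
    fix i assume i: "i + 2 < length p"
    then have "(p @ q) ! (i + 2) \<noteq> (p @ q) ! i"
      using assms(1) unfolding cover_verts_def nonbacktracking_def by simp
    then show "p ! (i + 2) \<noteq> p ! i" using i by (simp add: nth_append)
  qed
  then show ?thesis using assms by (auto simp: cover_verts_def walk_def successively_append_iff)
qed

lemma cover_closer_exists:
  assumes c: "c \<in> cover_verts V E v0" and x: "x \<in> cover_verts V E v0" "x \<noteq> c"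
  shows "\<exists>y. y \<in> cover_verts V E v0 \<and> {x, y} \<in> cover_edges V E v0 \<and> path_dist x c = Suc (path_dist y c)"
proof (cases "prefix x c")
  case True
  then obtain ys where "c = x @ ys" by (auto simp: prefix_def)
  moreover then obtain v zs where "ys = v # zs" using x by (cases ys) auto
  ultimately have "c = (x @ [v]) @ zs" by simp
  then have "x @ [v] \<in> cover_verts V E v0" "prefix (x @ [v]) c"
    using c cover_verts_prefix[of "x @ [v]" zs] by auto
  then show ?thesis using x path_dist_snoc[of x v c] unfolding cover_edges_def by auto
next
  case False
  have "x \<noteq> []" using x by (auto simp: cover_verts_def walk_def)
  then obtain y v where yv: "x = y @ [v]" by (cases x rule: rev_cases) auto
  have "y \<noteq> []"
    using False c x yv by (cases c) (auto simp: cover_verts_def walk_def)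
  then have "y \<in> cover_verts V E v0" using cover_verts_prefix x yv by metis
  moreover then have "{x, y} \<in> cover_edges V E v0"
    using x yv unfolding cover_edges_def by (auto simp: insert_commute)
  ultimately show ?thesis using path_dist_snoc[of y v c] False yv by auto
qed

lemma cover_graph_dist:
  assumes c: "c \<in> cover_verts V E v0" and x: "x \<in> cover_verts V E v0"
  shows "graph_dist (cover_verts V E v0) (cover_edges V E v0) x c = path_dist x c"
proof (rule graph_dist_eqI[OF c _ x])
  fix x y assume "{x, y} \<in> cover_edges V E v0"
  then obtain v where "y = x @ [v] \<or> x = y @ [v]" by (rule cover_edgeE)
  then show "path_dist x c \<le> Suc (path_dist y c)"
    using path_dist_snoc[of x v c] path_dist_snoc[of y v c] by (auto split: if_splits)
qed (use cover_closer_exists[OF c] in auto)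

lemma cover_metric_tree: "metric_tree (cover_verts V E v0) (cover_edges V E v0)"
proof
  let ?T = "cover_verts V E v0" and ?F = "cover_edges V E v0"
  show "simple_graph ?T ?F"
    by (auto simp: simple_graph_def cover_edges_def)
  fix x y c
  show "graph_dist ?T ?F x y = 0 \<longleftrightarrow> x = y" if "x \<in> ?T" "y \<in> ?T"
    using that by (simp add: cover_graph_dist)
  show "graph_dist ?T ?F x y = graph_dist ?T ?F y x" if "x \<in> ?T" "y \<in> ?T"
    using that by (simp add: cover_graph_dist path_dist_commute)
  show "graph_dist ?T ?F x c = Suc (graph_dist ?T ?F y c) \<or> graph_dist ?T ?F y c = Suc (graph_dist ?T ?F x c)"
    if xy: "{x, y} \<in> ?F" and c: "c \<in> ?T"
  proof -
    obtain v where v: "x \<in> ?T" "y \<in> ?T" "y = x @ [v] \<or> x = y @ [v]" using xy by (rule cover_edgeE)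
    then show ?thesis
      using path_dist_snoc[of x v c] path_dist_snoc[of y v c] c
      by (auto simp: cover_graph_dist split: if_splits)
  qed
  show "\<exists>y. {x, y} \<in> ?F \<and> graph_dist ?T ?F x c = Suc (graph_dist ?T ?F y c)"
    if "c \<in> ?T" "x \<in> ?T" "x \<noteq> c"
    using cover_closer_exists[OF that] that by (auto simp: cover_graph_dist)
  fix z
  show "y = z" if c: "c \<in> ?T" and y: "{x, y} \<in> ?F" and z: "{x, z} \<in> ?F"
    and "graph_dist ?T ?F x c = Suc (graph_dist ?T ?F y c)" "graph_dist ?T ?F x c = Suc (graph_dist ?T ?F z c)"
  proof -
    have T: "x \<in> ?T" "y \<in> ?T" "z \<in> ?T" using y z by (auto elim: cover_edgeE)
    with that have d: "path_dist x c = Suc (path_dist y c)" "path_dist x c = Suc (path_dist z c)"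
      by (simp_all add: cover_graph_dist)
    show ?thesis
      using d[unfolded cover_closer_iff[OF y]  cover_closer_iff[OF z]]
      by (auto simp: prefix_def)
  qed
qed

lemma cover_edge_last:
  assumes "{w, z} \<in> cover_edges V E v0"
  shows "{last w, last z} \<in> E"
proof -
  have *: "{last p, v} \<in> E" if "p \<in> cover_verts V E v0" "p @ [v] \<in> cover_verts V E v0" for p v
    using that by (auto simp: cover_verts_def walk_def successively_append_iff)
  obtain v where "w \<in> cover_verts V E v0" "z \<in> cover_verts V E v0" "z = w @ [v] \<or> w = z @ [v]"
    using assms by (rule cover_edgeE)
  then show ?thesis using *[of w v] *[of z v] by (auto simp: insert_commute)
qed

text \<open>
  The projection is a local isomorphism. The neighbours of a path \<open>w\<close> are its one-step extensions and the
  path with its last vertex erased; non-backtracking is what keeps the ends of the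
  former apart from the end of the latter.
\<close>

lemma cover_nbrs_bij:
  assumes simple: "simple_graph V E" and w: "w \<in> cover_verts V E v0"
  shows "bij_betw last (nbrs (cover_edges V E v0) w) (nbrs E (last w))"
proof (rule bij_betw_imageI)
  show "last ` nbrs (cover_edges V E v0) w = nbrs E (last w)"
  proof
    show "last ` nbrs (cover_edges V E v0) w \<subseteq> nbrs E (last w)"
      using cover_edge_last by (force simp: nbrs_def)
    show "nbrs E (last w) \<subseteq> last ` nbrs (cover_edges V E v0) w"
    proof
      fix x assume "x \<in> nbrs E (last w)"
      then have "{last w, x} \<in> E" "x \<in> V" using simple by (auto simp: nbrs_def simple_graph_def)
      from cover_step[OF w this] show "x \<in> last ` nbrs (cover_edges V E v0) w"
        by (auto simp: nbrs_def)
    qed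
  qed
  have up_down: "last y \<noteq> last z" if "w = y @ [u]" "z = w @ [v]" "z \<in> cover_verts V E v0" "y \<in> cover_verts V E v0" for y z u v
  proof -
    have y: "y \<noteq> []" using that by (auto simp: cover_verts_def walk_def)
    have "z ! (length y - 1 + 2) \<noteq> z ! (length y - 1)"
      using that y unfolding cover_verts_def nonbacktracking_def by (auto simp: neq_Nil_conv)
    moreover have "z ! (length y - 1) = last y"
      using that y by (simp add: nth_append last_conv_nth)
    moreover have "z ! (length y - 1 + 2) = v"
      using that y by (cases y) (simp_all add: nth_append)
    ultimately show ?thesis using that by auto
  qed
  show "inj_on last (nbrs (cover_edges V E v0) w)"
  proof (rule inj_onI)
    fix y z
    assume yz: "y \<in> nbrs (cover_edges V E v0) w" "z \<in> nbrs (cover_edges V E v0) w" "last y = last z"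
    then have "{w, y} \<in> cover_edges V E v0" "{w, z} \<in> cover_edges V E v0" by (auto simp: nbrs_def)
    then obtain u v where y: "y \<in> cover_verts V E v0" "y = w @ [u] \<or> w = y @ [u]"
      and z: "z \<in> cover_verts V E v0" "z = w @ [v] \<or> w = z @ [v]"
      by (metis cover_edgeE)
    from y(2) z(2) show "y = z"
    proof (elim disjE)
      assume "y = w @ [u]" "z = w @ [v]"
      then show ?thesis using yz(3) by simp
    next
      assume "w = y @ [u]" "w = z @ [v]"
      then show ?thesis by (metis append1_eq_conv)
    next
      assume "w = y @ [u]" "z = w @ [v]"
      then show ?thesis using up_down z(1) y(1) yz(3) by metis
    next
      assume "y = w @ [u]" "w = z @ [v]"
      then show ?thesis using up_down z(1) y(1) yz(3) by metis
    qed
  qed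
qed

section \<open>The non-backtracking averaging operator\<close>

definition nonbacktracking_average :: "'a set set \<Rightarrow> ('a \<times> 'a \<Rightarrow> real) \<Rightarrow> 'a \<times> 'a \<Rightarrow> real" where
  "nonbacktracking_average E F = (\<lambda>(u, v). (\<Sum>x\<in>nbrs E v - {u}. F (v, x)) / real (card (nbrs E v - {u})))"

text \<open>
  Functions on directed edges that are constant on the edges leaving any given vertex and on the edges
  entering it. On a connected graph they are the constants and, if the graph is bipartite, the
  combinations of the indicators of the two orientations of the edges across the bipartition. The
  averaging operator preserves their norm, and two steps of it strictly contract everything orthogonal
  to them.
\<close>

definition star_constant :: "'a set set \<Rightarrow> ('a \<times> 'a \<Rightarrow> real) \<Rightarrow> bool" where
  "star_constant E H \<longleftrightarrow> (\<forall>v. \<forall>x\<in>nbrs E v. \<forall>y\<in>nbrs E v. H (v, x) = H (v, y) \<and> H (x, v) = H (y, v))"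

definition star_orthogonal :: "'a set set \<Rightarrow> ('a \<times> 'a \<Rightarrow> real) \<Rightarrow> bool" where
  "star_orthogonal E F \<longleftrightarrow> (\<forall>H. star_constant E H \<longrightarrow> (\<Sum>a\<in>directed_edges E. F a * H a) = 0)"

definition energy :: "'a set set \<Rightarrow> ('a \<times> 'a \<Rightarrow> real) \<Rightarrow> real" where
  "energy E F = (\<Sum>a\<in>directed_edges E. (F a)\<^sup>2)"

lemma star_constantD:
  assumes "star_constant E H" "x \<in> nbrs E v" "y \<in> nbrs E v"
  shows "H (v, x) = H (v, y)" "H (x, v) = H (y, v)"
  using assms unfolding star_constant_def by blast+

lemma directed_edges_iff: "(u, v) \<in> directed_edges E \<longleftrightarrow> v \<in> nbrs E u"
  by (simp add: directed_edges_def nbrs_def)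

lemma nbrs_sym: "v \<in> nbrs E u \<longleftrightarrow> u \<in> nbrs E v"
  by (simp add: nbrs_def insert_commute)

text \<open>
  Averaging over all but one of the points contracts the sum of squares, and the loss is
  proportional to the variance. Hence there is no loss only for constant functions.
\<close>

lemma sum_leave_one_out_squares:
  fixes h :: "'b \<Rightarrow> real"
  assumes fin: "finite N" and card: "card N = Suc q" and q: "q > 0"
  shows "(\<Sum>u\<in>N. (sum h (N - {u}) / real q)\<^sup>2) =
    (\<Sum>x\<in>N. (h x)\<^sup>2) - (real q - 1) / (2 * (real q)\<^sup>2) * (\<Sum>x\<in>N. \<Sum>y\<in>N. (h x - h y)\<^sup>2)"
proof -
  define s where "s = sum h N"
  define t where "t = (\<Sum>x\<in>N. (h x)\<^sup>2)"
  have "(\<Sum>u\<in>N. (sum h (N - {u}) / real q)\<^sup>2) = (\<Sum>u\<in>N. (s - h u)\<^sup>2) / (real q)\<^sup>2"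
    using fin by (simp add: sum_diff1 s_def power_divide sum_divide_distrib)
  also have "(\<Sum>u\<in>N. (s - h u)\<^sup>2) = (\<Sum>u\<in>N. s\<^sup>2 + (h u)\<^sup>2 - (2 * s) * h u)"
    by (simp add: power2_diff)
  also have "\<dots> = real (Suc q) * s\<^sup>2 + t - (2 * s) * s"
    unfolding sum_subtractf sum.distrib sum_distrib_left[symmetric] by (simp add: card t_def s_def)
  also have "\<dots> = (real q - 1) * s\<^sup>2 + t"
    by (simp add: algebra_simps power2_eq_square)
  finally have 1: "(\<Sum>u\<in>N. (sum h (N - {u}) / real q)\<^sup>2) = ((real q - 1) * s\<^sup>2 + t) / (real q)\<^sup>2" .
  have "(\<Sum>y\<in>N. (h x - h y)\<^sup>2) = real (Suc q) * (h x)\<^sup>2 + t - (2 * s) * h x" for x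
  proof -
    have "(\<Sum>y\<in>N. (h x - h y)\<^sup>2) = (\<Sum>y\<in>N. (h x)\<^sup>2 + (h y)\<^sup>2 - (2 * h x) * h y)"
      by (simp add: power2_diff)
    also have "\<dots> = real (Suc q) * (h x)\<^sup>2 + t - (2 * h x) * s"
      unfolding sum_subtractf sum.distrib sum_distrib_left[symmetric] by (simp add: card t_def s_def)
    finally show ?thesis by simp
  qed
  then have "(\<Sum>x\<in>N. \<Sum>y\<in>N. (h x - h y)\<^sup>2) =
      (\<Sum>x\<in>N. real (Suc q) * (h x)\<^sup>2 + t - (2 * s) * h x)" by simp
  also have "\<dots> = real (Suc q) * t + real (Suc q) * t - (2 * s) * s"
    unfolding sum_subtractf sum.distrib sum_distrib_left[symmetric] by (simp add: card t_def s_def)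
  also have "\<dots> = 2 * (real q + 1) * t - 2 * s\<^sup>2"
    by (simp add: algebra_simps power2_eq_square)
  finally have 2: "(\<Sum>x\<in>N. \<Sum>y\<in>N. (h x - h y)\<^sup>2) = 2 * (real q + 1) * t - 2 * s\<^sup>2" .
  show ?thesis
    unfolding 1 2 t_def[symmetric] using q by (simp add: field_simps power2_eq_square)
qed

text \<open>
  Functions supported on \<open>D\<close> form a product of compact intervals and points, so that
  the extreme value theorem applies to them without choosing coordinates.
\<close>

lemma compact_supported_functions:
  fixes D :: "'b set"
  shows "compact {F :: 'b \<Rightarrow> real. (\<forall>a\<in>D. F a \<in> {-1..1}) \<and> (\<forall>a. a \<notin> D \<longrightarrow> F a = 0)}"
proof -
  have "compactin (product_topology (\<lambda>i. euclidean) UNIV) (PiE UNIV (\<lambda>a. if a \<in> D then {-1..1::real} else {0}))"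
    by (subst compactin_PiE) auto
  then have "compact (PiE UNIV (\<lambda>a. if a \<in> D then {-1..1::real} else {0}))"
    by (simp add: euclidean_product_topology)
  also have "PiE UNIV (\<lambda>a. if a \<in> D then {-1..1::real} else {0}) =
    {F. (\<forall>a\<in>D. F a \<in> {-1..1}) \<and> (\<forall>a. a \<notin> D \<longrightarrow> F a = 0)}"
    by (fastforce simp: PiE_def Pi_def split: if_splits)
  finally show ?thesis .
qed

text \<open>
  The degree is \<open>q + 1\<close>, so that \<open>q\<close> non-backtracking continuations follow each directed edge.
\<close>

locale connected_regular_graph =
  fixes V :: "'a set" and E :: "'a set set" and q :: nat
  assumes finite_V: "finite V"
    and simple: "simple_graph V E"
    and connected: "connected_graph V E"
    and degree: "v \<in> V \<Longrightarrow> card (nbrs E v) = Suc q"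
    and q_ge_2: "q \<ge> 2"
begin

abbreviation "D \<equiv> directed_edges E"
abbreviation "P \<equiv> nonbacktracking_average E"

lemma edge_in: "{x, y} \<in> E \<Longrightarrow> x \<in> V \<and> y \<in> V \<and> x \<noteq> y"
  using simple by (force simp: simple_graph_def)

lemma nbrs_in: "x \<in> nbrs E v \<Longrightarrow> x \<in> V \<and> v \<in> V"
  using edge_in by (auto simp: nbrs_def)

lemma finite_nbrs [simp]: "finite (nbrs E v)"
  using nbrs_in finite_V by (metis finite_subset subsetI)

lemma directed_edges_Sigma: "D = Sigma V (nbrs E)"
  using nbrs_in by (auto simp: directed_edges_iff)

lemma finite_D [simp]: "finite D"
  using finite_V by (simp add: directed_edges_Sigma)

lemma rev_D: "bij_betw prod.swap D D"
  by (rule bij_betwI[where g = prod.swap]) (auto simp: directed_edges_iff nbrs_sym)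

lemma sum_out: "(\<Sum>a\<in>D. F a) = (\<Sum>v\<in>V. \<Sum>x\<in>nbrs E v. F (v, x))"
  unfolding directed_edges_Sigma using finite_V by (simp add: sum.Sigma)

lemma sum_rev: "(\<Sum>a\<in>D. F (prod.swap a)) = (\<Sum>a\<in>D. F a)"
  using rev_D by (rule sum.reindex_bij_betw)

lemma sum_in: "(\<Sum>a\<in>D. F a) = (\<Sum>v\<in>V. \<Sum>u\<in>nbrs E v. F (u, v))"
  using sum_out[of "\<lambda>a. F (prod.swap a)"] sum_rev[of F] by simp

lemma card_punctured: "(u, v) \<in> D \<Longrightarrow> card (nbrs E v - {u}) = q"
  using degree[of v] nbrs_in[of v u] by (simp add: directed_edges_iff nbrs_sym[of u])

lemma nonbacktracking_average_eq: "(u, v) \<in> D \<Longrightarrow> P F (u, v) = (\<Sum>x\<in>nbrs E v - {u}. F (v, x)) / real q"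
  by (simp add: nonbacktracking_average_def card_punctured)

lemma energy_nonbacktracking_average:
  "energy E (P F) = energy E F
     - (real q - 1) / (2 * (real q)\<^sup>2) * (\<Sum>v\<in>V. \<Sum>x\<in>nbrs E v. \<Sum>y\<in>nbrs E v. (F (v, x) - F (v, y))\<^sup>2)"
proof -
  have "energy E (P F) = (\<Sum>v\<in>V. \<Sum>u\<in>nbrs E v. (sum (\<lambda>x. F (v, x)) (nbrs E v - {u}) / real q)\<^sup>2)"
    unfolding energy_def sum_in
    by (intro sum.cong refl) (simp add: nonbacktracking_average_eq directed_edges_iff nbrs_sym)
  also have "\<dots> = (\<Sum>v\<in>V. (\<Sum>x\<in>nbrs E v. (F (v, x))\<^sup>2) -
      (real q - 1) / (2 * (real q)\<^sup>2) * (\<Sum>x\<in>nbrs E v. \<Sum>y\<in>nbrs E v. (F (v, x) - F (v, y))\<^sup>2))"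
    using q_ge_2 by (intro sum.cong refl sum_leave_one_out_squares) (auto simp: degree)
  finally show ?thesis by (simp add: energy_def sum_out sum_subtractf sum_distrib_left)
qed

lemma energy_nonneg: "energy E F \<ge> 0"
  by (simp add: energy_def sum_nonneg)

lemma energy_nonbacktracking_average_le: "energy E (P F) \<le> energy E F"
  using q_ge_2 by (simp add: energy_nonbacktracking_average sum_nonneg)

lemma energy_nonbacktracking_average_eq_imp:
  assumes eq: "energy E (P F) = energy E F" and xy: "x \<in> nbrs E v" "y \<in> nbrs E v"
  shows "F (v, x) = F (v, y)"
proof -
  have "(\<Sum>v\<in>V. \<Sum>x\<in>nbrs E v. \<Sum>y\<in>nbrs E v. (F (v, x) - F (v, y))\<^sup>2) = 0"
    using eq q_ge_2 by (simp add: energy_nonbacktracking_average)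
  then have "\<forall>v\<in>V. (\<Sum>x\<in>nbrs E v. \<Sum>y\<in>nbrs E v. (F (v, x) - F (v, y))\<^sup>2) = 0"
    by (subst (asm) sum_nonneg_eq_0_iff) (auto simp: finite_V intro!: sum_nonneg)
  then have "(\<Sum>x\<in>nbrs E v. \<Sum>y\<in>nbrs E v. (F (v, x) - F (v, y))\<^sup>2) = 0"
    using nbrs_in[OF xy(1)] by blast
  then have "\<forall>x\<in>nbrs E v. (\<Sum>y\<in>nbrs E v. (F (v, x) - F (v, y))\<^sup>2) = 0"
    by (subst (asm) sum_nonneg_eq_0_iff) (auto intro!: sum_nonneg)
  then have "(\<Sum>y\<in>nbrs E v. (F (v, x) - F (v, y))\<^sup>2) = 0"
    using xy(1) by blast
  then have "(F (v, x) - F (v, y))\<^sup>2 = 0"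
    using xy(2) by (subst (asm) sum_nonneg_eq_0_iff) auto
  then show ?thesis by simp
qed

text \<open>
  If the first step loses no energy, \<open>F\<close> depends only on the tail of an edge. Its average at \<open>(v, x)\<close> is
  then the common value on the edges leaving \<open>x\<close>, that is \<open>F (x, v)\<close>; if the second step loses no
  energy either, this depends only on \<open>v\<close>.
\<close>

lemma star_constant_if_energy_kept:
  assumes eq: "energy E (P (P F)) = energy E F"
  shows "star_constant E F"
proof -
  have e: "energy E (P F) = energy E F" "energy E (P (P F)) = energy E (P F)"
    using eq energy_nonbacktracking_average_le[of F] energy_nonbacktracking_average_le[of "P F"] by auto
  have outgoing: "F (v, x) = F (v, y)" if "x \<in> nbrs E v" "y \<in> nbrs E v" for v x y
    using energy_nonbacktracking_average_eq_imp[OF e(1)] that .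
  have P: "P F (v, x) = F (x, v)" if "x \<in> nbrs E v" for v x
  proof -
    have "(v, x) \<in> D" "v \<in> nbrs E x" using that by (auto simp: directed_edges_iff nbrs_sym)
    moreover have "(\<Sum>z\<in>nbrs E x - {v}. F (x, z)) = (\<Sum>z\<in>nbrs E x - {v}. F (x, v))"
      using outgoing that by (intro sum.cong refl) (auto simp: nbrs_sym)
    then have "(\<Sum>z\<in>nbrs E x - {v}. F (x, z)) = real q * F (x, v)"
      unfolding sum_constant card_punctured[OF \<open>(v, x) \<in> D\<close>] by simp
    ultimately show ?thesis using q_ge_2 by (simp add: nonbacktracking_average_eq)
  qed
  have ingoing: "F (x, v) = F (y, v)" if "x \<in> nbrs E v" "y \<in> nbrs E v" for v x y
    using energy_nonbacktracking_average_eq_imp[OF e(2) that] P that by simp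
  show ?thesis
    unfolding star_constant_def by (intro allI ballI conjI; rule outgoing ingoing; assumption)
qed

lemma star_constant_rev:
  assumes "star_constant E H"
  shows "star_constant E (\<lambda>a. H (prod.swap a))"
  unfolding star_constant_def swap_simp
  by (intro allI ballI conjI; rule star_constantD[OF assms]; assumption)

text \<open>
  On star-constant functions the adjoint of the averaging operator is the reversal of edges, because the
  adjoint averages over the edges entering the tail of an edge.
\<close>

lemma sum_nonbacktracking_average_mult:
  assumes H: "star_constant E H"
  shows "(\<Sum>a\<in>D. P F a * H a) = (\<Sum>a\<in>D. F a * H (prod.swap a))"
proof -
  have "(\<Sum>a\<in>D. P F a * H a) = (\<Sum>v\<in>V. \<Sum>u\<in>nbrs E v. \<Sum>x\<in>nbrs E v - {u}. F (v, x) * H (u, v) / q)"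
    unfolding sum_in
  proof (intro sum.cong refl)
    fix v u assume "u \<in> nbrs E v"
    then have "(u, v) \<in> D" by (simp add: directed_edges_iff nbrs_sym[of v])
    then show "P F (u, v) * H (u, v) = (\<Sum>x\<in>nbrs E v - {u}. F (v, x) * H (u, v) / q)"
      by (simp add: nonbacktracking_average_eq flip: sum_divide_distrib sum_distrib_right)
  qed
  also have "\<dots> = (\<Sum>v\<in>V. \<Sum>u\<in>nbrs E v. \<Sum>x\<in>nbrs E v - {u}. F (v, x) * H (x, v) / q)"
  proof (intro sum.cong refl)
    fix v u x assume "u \<in> nbrs E v" "x \<in> nbrs E v - {u}"
    then have "H (u, v) = H (x, v)" using star_constantD(2)[OF H] by blast
    then show "F (v, x) * H (u, v) / q = F (v, x) * H (x, v) / q" by simp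
  qed
  also have "\<dots> = (\<Sum>v\<in>V. \<Sum>x\<in>nbrs E v. \<Sum>u\<in>nbrs E v - {x}. F (v, x) * H (x, v) / q)"
  proof (rule sum.cong[OF refl])
    fix v
    show "(\<Sum>u\<in>nbrs E v. \<Sum>x\<in>nbrs E v - {u}. F (v, x) * H (x, v) / q) =
      (\<Sum>x\<in>nbrs E v. \<Sum>u\<in>nbrs E v - {x}. F (v, x) * H (x, v) / q)"
      using sum.swap_restrict[of "nbrs E v" "nbrs E v" "\<lambda>u x. F (v, x) * H (x, v) / q" "\<lambda>u x. x \<noteq> u"]
      by (simp add: set_diff_eq neq_commute)
  qed
  also have "\<dots> = (\<Sum>v\<in>V. \<Sum>x\<in>nbrs E v. F (v, x) * H (x, v))"
  proof (intro sum.cong refl)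
    fix v x assume "x \<in> nbrs E v"
    then have "card (nbrs E v - {x}) = q"
      using card_punctured[of x v] by (simp add: directed_edges_iff nbrs_sym[of v])
    then show "(\<Sum>u\<in>nbrs E v - {x}. F (v, x) * H (x, v) / q) = F (v, x) * H (x, v)"
      unfolding sum_constant using q_ge_2 by simp
  qed
  finally show ?thesis by (simp add: sum_out)
qed

lemma star_orthogonal_nonbacktracking_average: "star_orthogonal E F \<Longrightarrow> star_orthogonal E (P F)"
  unfolding star_orthogonal_def using sum_nonbacktracking_average_mult star_constant_rev by metis

text \<open>
  Every edge at a vertex \<open>v\<close> carries, in either direction, the value on the edges leaving \<open>v\<close>. Neighbouring
  vertices share an edge, so that connectedness makes this value the same everywhere.
\<close>

lemma star_constant_symmetric:
  assumes H: "star_constant E H" and sym: "\<And>u v. (u, v) \<in> D \<Longrightarrow> H (u, v) = H (v, u)"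
    and a: "a \<in> D" and b: "b \<in> D"
  shows "H a = H b"
proof -
  have walk: "H (hd p, x) = H (last p, y)"
    if "walk V E p" "x \<in> nbrs E (hd p)" "y \<in> nbrs E (last p)" for p x y
    using that
  proof (induction p arbitrary: x)
    case Nil
    then show ?case by (simp add: walk_def)
  next
    case (Cons u p)
    show ?case
    proof (cases "p = []")
      case True
      then have "H (u, x) = H (u, y)"
        using Cons.prems by (intro star_constantD(1)[OF H]) simp_all
      then show ?thesis using True by simp
    next
      case False
      with Cons.prems have p: "walk V E p" "hd p \<in> nbrs E u" "y \<in> nbrs E (last p)"
        by (auto simp: walk_def successively_Cons nbrs_def)
      have "H (u, x) = H (u, hd p)" 
        using Cons.prems p(2) by (intro star_constantD(1)[OF H]) simp_all
      also have "\<dots> = H (hd p, u)" using sym[of u "hd p"] p(2) by (simp add: directed_edges_iff)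
      also have "\<dots> = H (last p, y)" using Cons.IH[OF p(1) _ p(3)] p(2) nbrs_sym by metis
      finally show ?thesis using False by simp
    qed
  qed
  obtain u x v y where ab: "a = (u, x)" "b = (v, y)" by fastforce
  then have xy: "x \<in> nbrs E u" "y \<in> nbrs E v" using a b by (auto simp: directed_edges_iff)
  then obtain p where "walk V E p" "hd p = u" "last p = v"
    using connected nbrs_in unfolding connected_graph_def by blast
  with walk[of p x y] xy ab show ?thesis by simp
qed

text \<open>
  A symmetric function pairs equally with \<open>H\<close> and with the reversal of \<open>H\<close>. Their sum is star-constant and
  symmetric, hence constant, and pairs to zero with a function of mean zero. This is why the eigenvalue
  \<open>-1\<close> of the averaging operator on a bipartite graph does no harm.
\<close>

lemma star_orthogonal_symmetric:
  assumes sym: "\<And>u v. (u, v) \<in> D \<Longrightarrow> F (u, v) = F (v, u)" and mean: "(\<Sum>a\<in>D. F a) = 0"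
  shows "star_orthogonal E F"
  unfolding star_orthogonal_def
proof (intro allI impI)
  fix H assume H: "star_constant E H"
  define T where "T = (\<lambda>a. H a + H (prod.swap a))"
  have T: "star_constant E T"
    unfolding star_constant_def T_def swap_simp
    by (intro allI ballI conjI arg_cong2[of _ _ _ _ "(+)"]; rule star_constantD[OF H]; assumption)
  have F: "F (prod.swap a) = F a" if "a \<in> D" for a
    using sym[of "fst a" "snd a"] that by (cases a) simp
  have "(\<Sum>a\<in>D. F a * H a) + (\<Sum>a\<in>D. F a * H (prod.swap a)) = (\<Sum>a\<in>D. F a * T a)"
    by (simp add: T_def sum.distrib algebra_simps)
  also have "(\<Sum>a\<in>D. F a * H (prod.swap a)) = (\<Sum>a\<in>D. F a * H a)"
    using sum_rev[of "\<lambda>a. F (prod.swap a) * H a"] F by simp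
  also have "(\<Sum>a\<in>D. F a * T a) = 0"
  proof (cases "D = {}")
    case False
    then obtain b where b: "b \<in> D" by blast
    have "(\<Sum>a\<in>D. F a * T a) = (\<Sum>a\<in>D. F a * T b)"
      by (intro sum.cong refl arg_cong2[of _ _ _ _ "(*)"] star_constant_symmetric[OF T _ _ b])
         (simp_all add: T_def add.commute)
    then show ?thesis using mean by (simp flip: sum_distrib_right)
  qed simp
  finally show "(\<Sum>a\<in>D. F a * H a) = 0" by simp
qed

lemma nonbacktracking_average_cong: "(\<And>a. a \<in> D \<Longrightarrow> F a = G a) \<Longrightarrow> a \<in> D \<Longrightarrow> P F a = P G a"
  by (cases a) (auto simp: nonbacktracking_average_def directed_edges_iff intro!: sum.cong)

lemma energy_cong: "(\<And>a. a \<in> D \<Longrightarrow> F a = G a) \<Longrightarrow> energy E F = energy E G"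
  by (simp add: energy_def)

lemma nonbacktracking_average_scale: "P (\<lambda>a. c * F a) = (\<lambda>a. c * P F a)"
  by (simp add: nonbacktracking_average_def fun_eq_iff sum_distrib_left)

lemma energy_scale: "energy E (\<lambda>a. c * F a) = c\<^sup>2 * energy E F"
  by (simp add: energy_def sum_distrib_left power_mult_distrib)

text \<open>
  Two steps strictly decrease the energy of every nonzero star-orthogonal function. The unit sphere
  of these functions is compact, so that the largest ratio is attained and is less than one.
\<close>

lemma spectral_gap:
  obtains \<rho> where "0 < \<rho>" "\<rho> < 1"
    "\<And>F. star_orthogonal E F \<Longrightarrow> energy E (P (P F)) \<le> \<rho> * energy E F"
proof -
  define S where "S = {F. (\<forall>a\<in>D. F a \<in> {-1..1}) \<and> (\<forall>a. a \<notin> D \<longrightarrow> F a = 0)} \<inter>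
    ({F. energy E F = 1} \<inter> (\<Inter>H\<in>{H. star_constant E H}. {F. (\<Sum>a\<in>D. F a * H a) = 0}))"
  have "compact S"
    unfolding S_def energy_def
    by (intro compact_Int_closed compact_supported_functions closed_Int closed_INT ballI
        closed_Collect_eq continuous_intros continuous_on_product_coordinates)
  have cont: "continuous_on S (\<lambda>F. energy E (P (P F)))"
  proof -
    have "continuous_on S (\<lambda>F. F a)" for a
      by (rule continuous_on_subset[OF continuous_on_product_coordinates]) simp
    then show ?thesis
      unfolding energy_def nonbacktracking_average_def case_prod_unfold divide_inverse
      by (intro continuous_on_sum continuous_on_power continuous_on_mult continuous_on_const)
  qed
  have S_iff: "F \<in> S \<longleftrightarrow> (\<forall>a. a \<notin> D \<longrightarrow> F a = 0) \<and> energy E F = 1 \<and> star_orthogonal E F" for F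
  proof -
    have "F a \<in> {-1..1}" if "energy E F = 1" "a \<in> D" for a
    proof -
      have "(F a)\<^sup>2 \<le> energy E F"
        unfolding energy_def using that by (intro member_le_sum) auto
      then have "\<bar>F a\<bar> \<le> 1" using that by (simp add: abs_square_le_1)
      then show ?thesis by auto
    qed
    then show ?thesis by (auto simp: S_def star_orthogonal_def)
  qed
  have lt: "energy E (P (P F)) < 1" if F: "F \<in> S" for F
  proof (rule ccontr)
    assume "\<not> ?thesis"
    then have "energy E (P (P F)) = energy E F"
      using F energy_nonbacktracking_average_le[of F] energy_nonbacktracking_average_le[of "P F"] by (simp add: S_iff)
    then have "star_constant E F" by (rule star_constant_if_energy_kept)
    moreover have "star_orthogonal E F" using F by (simp add: S_iff)
    ultimately have "(\<Sum>a\<in>D. F a * F a) = 0" unfolding star_orthogonal_def by blast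
    then have "energy E F = 0" by (simp add: energy_def power2_eq_square)
    then show False using F by (simp add: S_iff)
  qed
  obtain m where m: "m < 1" "\<And>F. F \<in> S \<Longrightarrow> energy E (P (P F)) \<le> m"
  proof (cases "S = {}")
    case True
    then show ?thesis using that[of 0] by simp
  next
    case False
    then obtain G where "G \<in> S" "\<forall>F\<in>S. energy E (P (P F)) \<le> energy E (P (P G))"
      using continuous_attains_sup[OF \<open>compact S\<close> _ cont] by blast
    then show ?thesis using that lt by blast
  qed
  have bound: "energy E (P (P F)) \<le> m * energy E F" if F: "star_orthogonal E F" for F
  proof (cases "energy E F = 0")
    case True
    then show ?thesis using energy_nonbacktracking_average_le[of F] energy_nonbacktracking_average_le[of "P F"] by simp
  next
    case False
    then have pos: "energy E F > 0" using energy_nonneg[of F] by simp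
    define c where "c = 1 / sqrt (energy E F)"
    \<comment> \<open>Values off \<open>D\<close> influence nothing, but the compact set \<open>S\<close> requires them to vanish.\<close>
    define G where "G = (\<lambda>a. if a \<in> D then c * F a else 0)"
    have GF: "G a = c * F a" if "a \<in> D" for a using that by (simp add: G_def)
    have c2: "c\<^sup>2 = 1 / energy E F" using pos by (simp add: c_def power_divide)
    have "energy E G = 1"
      using energy_cong[OF GF] pos by (simp add: energy_scale c2)
    moreover have "star_orthogonal E G"
      using F unfolding star_orthogonal_def
      by (simp add: GF mult.assoc cong: sum.cong flip: sum_distrib_left)
    ultimately have "energy E (P (P G)) \<le> m" by (intro m) (simp add: S_iff G_def)
    also have "energy E (P (P G)) = c\<^sup>2 * energy E (P (P F))"
    proof -
      have "energy E (P (P G)) = energy E (P (P (\<lambda>a. c * F a)))"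
        by (intro energy_cong nonbacktracking_average_cong GF)
      then show ?thesis by (simp add: nonbacktracking_average_scale energy_scale)
    qed
    finally show ?thesis using pos by (simp add: c2 field_simps)
  qed
  show thesis
  \<comment> \<open>The largest ratio may be \<open>0\<close>; the maximum keeps \<open>\<rho>\<close> positive.\<close>
  proof (rule that[of "max m (1/2)"])
    show "energy E (P (P F)) \<le> max m (1/2) * energy E F" if "star_orthogonal E F" for F
      using bound[OF that] energy_nonneg[of F]
      by (meson max.cobounded1 mult_right_mono order_trans)
  qed (use m in auto)
qed

section \<open>Decay of arc averages\<close>

text \<open>
  The gap concerns two steps at once; for odd \<open>r\<close> the remaining step is covered by contraction.
\<close>

lemma energy_power_decay:
  assumes F: "star_orthogonal E F" and \<rho>: "0 < \<rho>"
    and gap: "\<And>F. star_orthogonal E F \<Longrightarrow> energy E (P (P F)) \<le> \<rho> * energy E F"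
  shows "energy E ((P ^^ r) F) \<le> \<rho> ^ (r div 2) * energy E F"
proof (induction r rule: less_induct)
  case (less r)
  have orth: "star_orthogonal E ((P ^^ k) F)" for k
    by (induction k) (auto simp: F star_orthogonal_nonbacktracking_average)
  consider "r = 0" | "r = 1" | k where "r = k + 2"
    by (metis One_nat_def Suc_pred add_2_eq_Suc' bot_nat_0.not_eq_extremum)
  then show ?case
  proof cases
    case 1
    then show ?thesis by simp
  next
    case 2
    then show ?thesis using energy_nonbacktracking_average_le by simp
  next
    case 3
    then have "energy E ((P ^^ r) F) \<le> \<rho> * energy E ((P ^^ k) F)" using gap[OF orth[of k]] by simp
    also have "\<dots> \<le> \<rho> * (\<rho> ^ (k div 2) * energy E F)"
      using less.IH[of k] 3 \<rho> by (intro mult_left_mono) auto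
    finally show ?thesis using 3 by simp
  qed
qed

lemma abs_le_sqrt_energy: "a \<in> D \<Longrightarrow> \<bar>F a\<bar> \<le> sqrt (energy E F)"
  unfolding energy_def
  by (intro real_le_rsqrt) (auto intro: member_le_sum[of a D "\<lambda>a. (F a)\<^sup>2"])

text \<open>
  Averaging fixes constants, so that subtracting the mean first does not change the deviation.
\<close>

lemma nonbacktracking_average_shift:
  assumes "a \<in> D" shows "(P ^^ r) (\<lambda>a. F a - c) a = (P ^^ r) F a - c"
  using assms
proof (induction r arbitrary: a)
  case (Suc r)
  obtain u v where a: "a = (u, v)" by fastforce
  have "P ((P ^^ r) (\<lambda>a. F a - c)) a = P (\<lambda>a. (P ^^ r) F a - c) a"
    using Suc by (intro nonbacktracking_average_cong) auto
  also have "\<dots> = P ((P ^^ r) F) a - c"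
    using Suc.prems q_ge_2 unfolding a
    by (simp add: nonbacktracking_average_eq sum_subtractf card_punctured diff_divide_distrib)
  finally show ?case by simp
qed simp

lemma edge_cases: "e \<in> E \<Longrightarrow> \<exists>x y. e = {x, y} \<and> x \<noteq> y"
  using simple by (auto simp: simple_graph_def card_2_iff)

lemma finite_E: "finite E"
proof (rule finite_subset)
  show "E \<subseteq> Pow V" using simple by (auto simp: simple_graph_def)
qed (simp add: finite_V)

lemma sum_directed_edges:
  fixes g :: "'a set \<Rightarrow> real"
  shows "(\<Sum>(u, v)\<in>D. g {u, v}) = 2 * (\<Sum>e\<in>E. g e)"
proof -
  have "(\<Sum>(u, v)\<in>D. g {u, v}) = (\<Sum>e\<in>E. \<Sum>(u, v)\<in>{a \<in> D. {fst a, snd a} = e}. g {u, v})"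
    by (rule sum.group[OF finite_D finite_E, symmetric]) (auto simp: directed_edges_def)
  also have "\<dots> = (\<Sum>e\<in>E. 2 * g e)"
  proof (rule sum.cong[OF refl])
    fix e assume "e \<in> E"
    then obtain x y where e: "e = {x, y}" "x \<noteq> y" using edge_cases by blast
    then have "{a \<in> D. {fst a, snd a} = e} = {(x, y), (y, x)}"
      using \<open>e \<in> E\<close> by (auto simp: directed_edges_def doubleton_eq_iff insert_commute)
    then show "(\<Sum>(u, v)\<in>{a \<in> D. {fst a, snd a} = e}. g {u, v}) = 2 * g e"
      using e by (simp add: insert_commute)
  qed
  finally show ?thesis by (simp add: sum_distrib_left)
qed

text \<open>
  Both sides satisfy the same recursion: the arc of radius \<open>r + 1\<close> of \<open>(w', w)\<close> is the disjoint union of the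
  arcs of radius \<open>r\<close> of the \<open>q\<close> edges \<open>(w, z)\<close> with \<open>z \<noteq> w'\<close>, and these project bijectively to the
  non-backtracking continuations in the graph.
\<close>

lemma edge_arc_cover_average:
  assumes b: "b \<in> directed_edges (cover_edges V E v0)"
  shows "(let A = edge_arc (cover_verts V E v0) (cover_edges V E v0) r b in
    finite A \<and> card A = q ^ r \<and>
    (\<Sum>x\<in>A. f (last ` x)) = real q ^ r * (P ^^ r) (\<lambda>(u, v). f {u, v}) (map_prod last last b))"
  using b
proof (induction r arbitrary: b)
  case 0
  then show ?case by (cases b) simp
next
  case (Suc r)
  let ?T = "cover_verts V E v0" and ?F = "cover_edges V E v0"
  let ?G = "(P ^^ r) (\<lambda>(u, v). f {u, v})"
  interpret T: metric_tree ?T ?F by (rule cover_metric_tree)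
  obtain w' w where b: "b = (w', w)" by fastforce
  then have edge: "{w', w} \<in> ?F" using Suc.prems by (simp add: directed_edges_def)
  then have w: "w \<in> ?T" "w' \<in> nbrs ?F w" 
    using T.edge_in by (auto simp: nbrs_def insert_commute)
  note bij = cover_nbrs_bij[OF simple w(1)]
  have last_edge: "(last w', last w) \<in> D"
    using cover_edge_last[OF edge] by (simp add: directed_edges_def)
  have bij': "bij_betw last (nbrs ?F w - {w'}) (nbrs E (last w) - {last w'})"
    using bij_betw_DiffI[OF bij, of "{w'}" "{last w'}"] w(2) bij by (auto simp: bij_betw_def)
  have fin: "finite (nbrs ?F w)" using bij bij_betw_finite finite_nbrs by blast
  have card: "card (nbrs ?F w - {w'}) = q"
    using bij_betw_same_card[OF bij'] card_punctured[OF last_edge] by simp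
  have IH: "finite (edge_arc ?T ?F r (w, z))" "card (edge_arc ?T ?F r (w, z)) = q ^ r"
    "(\<Sum>x\<in>edge_arc ?T ?F r (w, z). f (last ` x)) = real q ^ r * ?G (last w, last z)"
    if "z \<in> nbrs ?F w" for z
    using Suc.IH[of "(w, z)"] that by (simp_all add: directed_edges_def nbrs_def Let_def)
  note step = T.sum_edge_arc_Suc[OF edge fin IH(1)]
  have "finite (edge_arc ?T ?F (Suc r) (w', w))"
    unfolding T.edge_arc_Suc[OF edge] using fin IH(1) by blast
  moreover have "card (edge_arc ?T ?F (Suc r) (w', w)) = q ^ Suc r"
  proof -
    have "card (edge_arc ?T ?F (Suc r) (w', w)) =
        (\<Sum>z\<in>nbrs ?F w - {w'}. card (edge_arc ?T ?F r (w, z)))"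
      using step[of "\<lambda>_. 1 :: nat"] by (simp del: edge_arc.simps)
    also have "\<dots> = (\<Sum>z\<in>nbrs ?F w - {w'}. q ^ r)"
      by (intro sum.cong refl IH(2)) auto
    finally show ?thesis using card by simp
  qed
  moreover have "(\<Sum>x\<in>edge_arc ?T ?F (Suc r) (w', w). f (last ` x)) =
      real q ^ Suc r * P ?G (last w', last w)"
  proof -
    have "(\<Sum>x\<in>edge_arc ?T ?F (Suc r) (w', w). f (last ` x)) =
        (\<Sum>z\<in>nbrs ?F w - {w'}. \<Sum>x\<in>edge_arc ?T ?F r (w, z). f (last ` x))"
      by (rule step)
    also have "\<dots> = (\<Sum>z\<in>nbrs ?F w - {w'}. real q ^ r * ?G (last w, last z))"
      by (intro sum.cong refl IH(3)) auto
    also have "\<dots> = real q ^ r * (\<Sum>x\<in>nbrs E (last w) - {last w'}. ?G (last w, x))"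
      using sum.reindex_bij_betw[OF bij', of "\<lambda>x. ?G (last w, x)"]
      by (simp flip: sum_distrib_left)
    also have "\<dots> = real q ^ Suc r * P ?G (last w', last w)"
      using q_ge_2 by (simp add: nonbacktracking_average_eq[OF last_edge])
    finally show ?thesis .
  qed
  ultimately show ?case by (simp add: b Let_def del: edge_arc.simps)
qed

lemma arc_average_eq:
  assumes "b \<in> directed_lifts V E v0 a"
  shows "arc_average V E v0 r b f = (P ^^ r) (\<lambda>(u, v). f {u, v}) a"
  using edge_arc_cover_average[of b v0 r f] assms q_ge_2
  by (auto simp: directed_lifts_def arc_average_def Let_def)

lemma energy_symmetric:
  "energy E (\<lambda>(u, v). g {u, v}) = 2 * (\<Sum>e\<in>E. (g e)\<^sup>2)"
  using sum_directed_edges[of "\<lambda>e. (g e)\<^sup>2"] by (simp add: energy_def case_prod_unfold)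

lemma sum_squares_deviation_le:
  fixes g :: "'b \<Rightarrow> real"
  shows "(\<Sum>x\<in>A. (g x - sum g A / real (card A))\<^sup>2) \<le> (\<Sum>x\<in>A. (g x)\<^sup>2)"
proof (cases "card A = 0")
  case False
  define m where "m = sum g A / real (card A)"
  have s: "sum g A = real (card A) * m" using False by (simp add: m_def)
  have "(\<Sum>x\<in>A. (g x - m)\<^sup>2) = (\<Sum>x\<in>A. (g x)\<^sup>2 + m\<^sup>2 - (2 * m) * g x)"
    by (simp add: power2_diff algebra_simps)
  also have "\<dots> = (\<Sum>x\<in>A. (g x)\<^sup>2) + real (card A) * m\<^sup>2 - (2 * m) * (real (card A) * m)"
    unfolding sum_subtractf sum.distrib sum_distrib_left[symmetric] s by simp
  also have "\<dots> = (\<Sum>x\<in>A. (g x)\<^sup>2) - real (card A) * m\<^sup>2"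
    by (simp add: power2_eq_square algebra_simps)
  finally show ?thesis by (simp add: m_def)
qed (auto simp: card_eq_0_iff)

text \<open>
  The energy is a squared norm and the gap \<open>\<rho>\<close> concerns two steps, so that the norm decays at the rate
  \<open>root 4 \<rho>\<close> per step. Raising the rate to at least \<open>q\<close> to the power \<open>- 1 / 2\<close> puts it in the
  required range and makes the loss of one step for odd \<open>r\<close> cost a factor of at most \<open>sqrt q\<close>. The
  other factor \<open>sqrt 2\<close> counts the two orientations of each edge.
\<close>

lemma arc_average_decay:
  obtains \<beta> where "real q powr (- 1 / 2) \<le> \<beta>" "\<beta> < 1"
    "\<And>f a r v0 b. a \<in> D \<Longrightarrow> b \<in> directed_lifts V E v0 a \<Longrightarrow>
      \<bar>arc_average V E v0 r b f - (\<Sum>e\<in>E. f e) / real (card E)\<bar>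
        \<le> sqrt (2 * real q) * L2_set f E * \<beta> ^ r"
proof -
  obtain \<rho> where \<rho>: "0 < \<rho>" "\<rho> < 1"
    "\<And>F. star_orthogonal E F \<Longrightarrow> energy E (P (P F)) \<le> \<rho> * energy E F"
    by (rule spectral_gap) (rule that; assumption)
  define \<beta> where "\<beta> = max (sqrt (sqrt \<rho>)) (1 / sqrt (real q))"
  have q: "real q \<ge> 2" using q_ge_2 by simp
  have \<beta>: "0 < \<beta>" "\<beta> < 1"
    using \<rho> q by (auto simp: \<beta>_def less_max_iff_disj)
  have \<rho>_le: "\<rho> \<le> \<beta> ^ 4"
  proof -
    have "(sqrt (sqrt \<rho>)) ^ (2 * 2) = \<rho>" unfolding power_mult using \<rho>(1) by simp
    then have "\<rho> = (sqrt (sqrt \<rho>)) ^ 4" by simp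
    also have "\<dots> \<le> \<beta> ^ 4" using \<rho>(1) by (intro power_mono) (auto simp: \<beta>_def)
    finally show ?thesis .
  qed
  have q_le: "1 \<le> real q * \<beta>\<^sup>2"
  proof -
    have "(1 / sqrt (real q))\<^sup>2 \<le> \<beta>\<^sup>2" by (intro power_mono) (auto simp: \<beta>_def)
    then show ?thesis using q by (simp add: power_divide field_simps)
  qed
  have rate: "\<rho> ^ (r div 2) \<le> real q * (\<beta> ^ r)\<^sup>2" for r
  proof -
    have "\<rho> ^ (r div 2) \<le> (\<beta> ^ 4) ^ (r div 2)" using \<rho>(1) \<rho>_le by (intro power_mono) auto
    also have "\<dots> = 1 * \<beta> ^ (4 * (r div 2))" by (simp add: power_mult)
    also have "\<dots> \<le> (real q * \<beta>\<^sup>2) * \<beta> ^ (4 * (r div 2))"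
      using q_le \<beta>(1) by (intro mult_right_mono) auto
    also have "\<dots> = real q * \<beta> ^ (2 + 4 * (r div 2))"
      unfolding power_add by simp
    also have "\<dots> \<le> real q * \<beta> ^ (r * 2)"
      using \<beta> by (intro mult_left_mono power_decreasing) auto
    finally show ?thesis by (simp add: power_mult)
  qed
  show thesis
  proof (rule that[OF _ \<beta>(2)])
    show "real q powr (- 1 / 2) \<le> \<beta>"
      using q by (simp add: \<beta>_def powr_minus_divide powr_half_sqrt)
  next
    fix f a r v0 b
    assume a: "a \<in> D" and b: "b \<in> directed_lifts V E v0 a"
    define m where "m = (\<Sum>e\<in>E. f e) / real (card E)"
    define F where "F = (\<lambda>(u, v). f {u, v} - m)"
    have "E \<noteq> {}" using a by (auto simp: directed_edges_def)
    then have "(\<Sum>e\<in>E. f e - m) = 0"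
      using finite_E by (simp add: sum_subtractf m_def)
    then have orth: "star_orthogonal E F"
      using sum_directed_edges[of "\<lambda>e. f e - m"]
      by (intro star_orthogonal_symmetric) (auto simp: F_def insert_commute)
    have "energy E F = 2 * (\<Sum>e\<in>E. (f e - m)\<^sup>2)"
      unfolding F_def by (rule energy_symmetric)
    also have "\<dots> \<le> 2 * (L2_set f E)\<^sup>2"
      using sum_squares_deviation_le[of f E] by (simp add: m_def L2_set_def sum_nonneg)
    finally have F_le: "energy E F \<le> 2 * (L2_set f E)\<^sup>2" .
    have "\<bar>arc_average V E v0 r b f - m\<bar> = \<bar>(P ^^ r) F a\<bar>"
      using nonbacktracking_average_shift[OF a, of r "\<lambda>(u, v). f {u, v}" m] arc_average_eq[OF b, of r f]
      by (simp add: F_def case_prod_unfold)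
    also have "\<dots> \<le> sqrt (energy E ((P ^^ r) F))" by (rule abs_le_sqrt_energy[OF a])
    also have "\<dots> \<le> sqrt (real q * (\<beta> ^ r)\<^sup>2 * (2 * (L2_set f E)\<^sup>2))"
    proof (rule real_sqrt_le_mono)
      have "energy E ((P ^^ r) F) \<le> \<rho> ^ (r div 2) * energy E F"
        using orth \<rho>(1,3) by (rule energy_power_decay)
      also have "\<dots> \<le> real q * (\<beta> ^ r)\<^sup>2 * (2 * (L2_set f E)\<^sup>2)"
        using rate F_le energy_nonneg by (intro mult_mono) auto
      finally show "energy E ((P ^^ r) F) \<le> real q * (\<beta> ^ r)\<^sup>2 * (2 * (L2_set f E)\<^sup>2)" .
    qed
    also have "\<dots> = sqrt (2 * real q) * L2_set f E * \<beta> ^ r"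
      using \<beta>(1) by (simp add: real_sqrt_mult)
    finally show "\<bar>arc_average V E v0 r b f - (\<Sum>e\<in>E. f e) / real (card E)\<bar>
        \<le> sqrt (2 * real q) * L2_set f E * \<beta> ^ r" by (simp add: m_def)
  qed
qed

end

text \<open>
  An edge meets \<open>d - 1\<close> other edges at each of its ends if all degrees are \<open>d\<close>, and no other edge
  meets it at both ends; hence \<open>2 q = 2 (d - 1)\<close>.
\<close>

lemma card_nbrs_of_edge_degree:
  assumes "finite V" and simple: "simple_graph V E" and "regular_graph V E"
    and deg: "\<forall>e\<in>E. edge_degree E e = 2 * q" and "E \<noteq> {}" and "v \<in> V"
  shows "card (nbrs E v) = Suc q"
proof -
  have "E \<subseteq> Pow V" using simple by (auto simp: simple_graph_def)
  then have finE: "finite E" using \<open>finite V\<close> finite_subset by blast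
  obtain d where d: "\<And>v. v \<in> V \<Longrightarrow> card {e \<in> E. v \<in> e} = d"
    using \<open>regular_graph V E\<close> unfolding regular_graph_def by blast
  obtain e where e: "e \<in> E" using \<open>E \<noteq> {}\<close> by blast
  then obtain x y where xy: "e = {x, y}" "x \<noteq> y" "x \<in> V" "y \<in> V"
    using simple by (auto simp: simple_graph_def card_2_iff)
  have "{e' \<in> E. e' \<noteq> e \<and> e' \<inter> e \<noteq> {}} = ({e \<in> E. x \<in> e} - {e}) \<union> ({e \<in> E. y \<in> e} - {e})"
    using xy by auto
  moreover have "({e \<in> E. x \<in> e} - {e}) \<inter> ({e \<in> E. y \<in> e} - {e}) = {}"
  proof -
    have "e' = e" if "e' \<in> E" "x \<in> e'" "y \<in> e'" for e'
      using that simple xy by (auto simp: simple_graph_def card_2_iff)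
    then show ?thesis by blast
  qed
  ultimately have "edge_degree E e = card ({e \<in> E. x \<in> e} - {e}) + card ({e \<in> E. y \<in> e} - {e})"
    unfolding edge_degree_def using finE by (simp add: card_Un_disjoint)
  also have "\<dots> = (d - 1) + (d - 1)"
    using e xy d by simp
  finally have "q = d - 1" using deg e by simp
  moreover have "d > 0"
    using d[OF xy(3)] e xy(1) finE by (auto simp: card_gt_0_iff)
  moreover have "bij_betw (\<lambda>x. {v, x}) (nbrs E v) {e \<in> E. v \<in> e}"
  proof (rule bij_betw_imageI)
    show "inj_on (\<lambda>x. {v, x}) (nbrs E v)" by (auto simp: inj_on_def doubleton_eq_iff)
    show "(\<lambda>x. {v, x}) ` nbrs E v = {e \<in> E. v \<in> e}"
    proof
      show "{e \<in> E. v \<in> e} \<subseteq> (\<lambda>x. {v, x}) ` nbrs E v"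
      proof
        fix e assume "e \<in> {e \<in> E. v \<in> e}"
        moreover then obtain x y where "e = {x, y}"
          using simple by (auto simp: simple_graph_def card_2_iff)
        ultimately show "e \<in> (\<lambda>x. {v, x}) ` nbrs E v"
          by (auto simp: nbrs_def insert_commute)
      qed
    qed (auto simp: nbrs_def)
  qed
  ultimately show ?thesis using bij_betw_same_card d[OF \<open>v \<in> V\<close>] by fastforce
qed

theorem theorem2:
  fixes V :: "'a set" and E :: "'a set set" and q :: nat
  assumes "finite V"
    and "simple_graph V E"
    and "connected_graph V E"
    and "regular_graph V E"
    and "\<forall>e\<in>E. edge_degree E e = 2 * q"
    and "2 * q \<ge> 4"
  shows "\<exists>C::real. C > 0 \<and>
    (\<forall>f :: 'a set \<Rightarrow> real.
      \<exists>\<beta>::real. \<beta> \<in> {1 / real q} \<union> {real q powr (- 1 / 2)..<1} \<and>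
        (\<forall>a\<in>directed_edges E. \<forall>r::nat. \<forall>v0\<in>V. \<forall>b\<in>directed_lifts V E v0 a.
          \<bar>arc_average V E v0 r b f - (\<Sum>e\<in>E. f e) / real (card E)\<bar>
            \<le> C * L2_set f E * \<beta> ^ r))"
proof (cases "E = {}")
  case True
  then have "directed_edges E = {}" by (simp add: directed_edges_def)
  then show ?thesis by (intro exI[of _ 1]) auto
next
  case False
  have "connected_regular_graph V E q"
    using assms card_nbrs_of_edge_degree[OF assms(1,2,4,5) False] by unfold_locales auto
  then interpret connected_regular_graph V E q .
  obtain \<beta> where \<beta>: "real q powr (- 1 / 2) \<le> \<beta>" "\<beta> < 1"
    "\<And>f a r v0 b. a \<in> directed_edges E \<Longrightarrow> b \<in> directed_lifts V E v0 a \<Longrightarrow>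
      \<bar>arc_average V E v0 r b f - (\<Sum>e\<in>E. f e) / real (card E)\<bar>
        \<le> sqrt (2 * real q) * L2_set f E * \<beta> ^ r"
    using arc_average_decay by blast
  then show ?thesis
    using q_ge_2 by (intro exI[of _ "sqrt (2 * real q)"] conjI allI exI[of _ \<beta>]) auto
qed

end
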